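(* Let $f:\mathbb{R}^n\to\mathbb{R}^n$ be a convex monotone homogeneous map. The length of any periodic orbit of $f$ divides the cyclicity $\mathsf{c}(f)$ of $f$.
   Context: $\leq$ is the entrywise order of $\mathbb{R}^n$ and $\lambda+x=(\lambda+x_1,\dots,\lambda+x_n)$. A map $f$ is monotone if $x\le y\Rightarrow f(x)\le f(y)$, (additively) homogeneous if $f(\lambda+x)=\lambda+f(x)$ for all $\lambda\in\mathbb{R}$, and convex if each coordinate is convex. A periodic orbit of $f$ is a set $\{f^k(x)\}_{k\in\mathbb{N}}$ with $f^c(x)=x$ for some $c\ge1$; its length is the smallest such $c\ge 1$. A monotone homogeneous map with a periodic orbit has a fixed point, so that the cyclicity below is defined. If $f$ has an eigenvector $v$ ($f(v)=\lambda+v$, $\lambda\in\mathbb{R}$; e.g. a fixed point), let $\partial f(v)=\{P\in\mathbb{R}^{n\times n}\mid f(x)-f(v)\ge P(x-v)\ \forall x\}$, whose elements are stochastic matrices. For a stochastic matrix $P$, $\mathscr{G}(P)$ is the directed graph on $\{1,\dots,n\}$ with arcs $i\to j$ when $P_{ij}\neq0$; its classes are the equivalence classes for mutual accessibility (each node has access to itself), a class is final if no node in it has access to a node outside it, and $\mathscr{G}^{f}(P)$ is the restriction of $\mathscr{G}(P)$ to the union of the final classes. The critical graph is $\mathscr{G}^{c}(f)=\bigcup_{P\in\partial f(v)}\mathscr{G}^{f}(P)$; it does not depend on the choice of the eigenvector $v$. If $\mathscr{G}_1,\dots,\mathscr{G}_s$ are its strongly connected components, $\mathsf{c}(\mathscr{G}_i)$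 is the gcd of the lengths of the circuits of $\mathscr{G}_i$ and $\mathsf{c}(f)=\mathrm{lcm}(\mathsf{c}(\mathscr{G}_1),\dots,\mathsf{c}(\mathscr{G}_s))$. *)

theory Defs
  imports "Graph_Theory.Graph_Theory" "HOL-Combinatorics.Cycles" "HOL-Analysis.Analysis"
begin

definition additively_homogeneous :: "(real^'n \<Rightarrow> real^'n) \<Rightarrow> bool" where
  "additively_homogeneous f \<longleftrightarrow> (\<forall>l x. f (vec l + x) = vec l + f x)"

definition convex_map :: "(real^'n \<Rightarrow> real^'n) \<Rightarrow> bool" where
  "convex_map f \<longleftrightarrow> (\<forall>i. convex_on UNIV (\<lambda>x. f x $ i))"

definition eigenvector :: "(real^'n \<Rightarrow> real^'n) \<Rightarrow> real^'n \<Rightarrow> bool" where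
  "eigenvector f v \<longleftrightarrow> (\<exists>l. f v = vec l + v)"

definition subdifferential :: "(real^'n \<Rightarrow> real^'n) \<Rightarrow> real^'n \<Rightarrow> (real^'n^'n) set" where
  "subdifferential f v = {P. \<forall>x. f x - f v \<ge> P *v (x - v)}"

definition matrix_graph :: "real^'n^'n \<Rightarrow> ('n, 'n \<times> 'n) pre_digraph" where
  "matrix_graph P = with_proj \<lparr>pverts = UNIV, parcs = {(i, j). P $ i $ j \<noteq> 0}\<rparr>"

definition final_classes :: "('a, 'b) pre_digraph \<Rightarrow> 'a set set" where
  "final_classes G =
     {C \<in> pre_digraph.sccs_verts G. \<forall>u \<in> C. \<forall>w. u \<rightarrow>\<^sup>*\<^bsub>G\<^esub> w \<longrightarrow> w \<in> C}"

definition final_graph :: "real^'n^'n \<Rightarrow> ('n, 'n \<times> 'n) pre_digraph" where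
  "final_graph P = matrix_graph P \<restriction> \<Union> (final_classes (matrix_graph P))"

definition critical_graph_at ::
    "(real^'n \<Rightarrow> real^'n) \<Rightarrow> real^'n \<Rightarrow> ('n, 'n \<times> 'n) pre_digraph" where
  "critical_graph_at f v = with_proj
     \<lparr>pverts = (\<Union>P \<in> subdifferential f v. verts (final_graph P)),
      parcs = (\<Union>P \<in> subdifferential f v. arcs (final_graph P))\<rparr>"

text \<open>
  When \<open>f\<close> has an eigenvector, its choice is immaterial for convex monotone homogeneous \<open>f\<close>, see \<open>critical_graph_eq\<close> below.
\<close>
definition critical_graph :: "(real^'n \<Rightarrow> real^'n) \<Rightarrow> ('n, 'n \<times> 'n) pre_digraph" where
  "critical_graph f = critical_graph_at f (SOME v. eigenvector f v)"

lemma wf_critical_graph_at: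
  fixes f :: "real^'n \<Rightarrow> real^'n"
  shows "wf_digraph (critical_graph_at f v)"
proof -
  have "tail (matrix_graph P) = fst" "head (matrix_graph P) = snd" for P :: "real^'n^'n"
    by (simp_all add: matrix_graph_def)
  then have "fst e \<in> verts (final_graph P)" "snd e \<in> verts (final_graph P)"
    if "e \<in> arcs (final_graph P)" for e and P :: "real^'n^'n"
    using that unfolding final_graph_def by (simp_all del: Union_iff)
  then show ?thesis
    by unfold_locales (simp_all add: critical_graph_at_def, blast+)
qed

text \<open>
  A circuit is a closed walk with at least one arc. Allowing repeated vertices does not change
  the gcd, since every closed walk decomposes into elementary ones.
\<close>
definition graph_cyclicity :: "('a, 'b) pre_digraph \<Rightarrow> nat" where
  "graph_cyclicity G = Gcd {length p |p. wf_digraph.closed_w G p}"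

definition cyclicity :: "(real^'n \<Rightarrow> real^'n) \<Rightarrow> nat" where
  "cyclicity f = Lcm (graph_cyclicity ` pre_digraph.sccs (critical_graph f))"


subsection \<open>Independence of the eigenvector\<close>

lemma subdifferential_iff:
  "P \<in> subdifferential f v \<longleftrightarrow> (\<forall>x i. (\<Sum>j\<in>UNIV. P $ i $ j * (x $ j - v $ j)) \<le> f x $ i - f v $ i)"
  by (auto simp: subdifferential_def less_eq_vec_def matrix_vector_mult_def)

lemma subdifferential_nonneg:
  assumes "mono f" "P \<in> subdifferential f v"
  shows "P $ i $ j \<ge> 0"
proof -
  have "v - axis j 1 \<le> v" by (auto simp: less_eq_vec_def axis_def)
  then have "f (v - axis j 1) \<le> f v" by (rule monoD[OF assms(1)])
  moreover have "(\<Sum>k\<in>UNIV. P $ i $ k * ((v - axis j 1) $ k - v $ k)) = - P $ i $ j"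
  proof -
    have "P $ i $ k * ((v - axis j 1) $ k - v $ k) = (if k = j then - P $ i $ k else 0)" for k
      by (simp add: axis_def)
    then show ?thesis by simp
  qed
  moreover have "(\<Sum>k\<in>UNIV. P $ i $ k * ((v - axis j 1) $ k - v $ k)) \<le> f (v - axis j 1) $ i - f v $ i"
    using assms(2) unfolding subdifferential_iff by blast
  moreover have "f (v - axis j 1) $ i \<le> f v $ i"
    using \<open>f (v - axis j 1) \<le> f v\<close> by (simp add: less_eq_vec_def)
  ultimately show ?thesis by linarith
qed

lemma subdifferential_row_sum:
  assumes "additively_homogeneous f" "P \<in> subdifferential f v"
  shows "(\<Sum>j\<in>UNIV. P $ i $ j) = 1"
proof -
  have "l * (\<Sum>j\<in>UNIV. P $ i $ j) \<le> l" for l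
  proof -
    have "(\<Sum>j\<in>UNIV. P $ i $ j * ((vec l + v) $ j - v $ j)) \<le> f (vec l + v) $ i - f v $ i"
      using assms(2) unfolding subdifferential_iff by blast
    moreover have "f (vec l + v) = vec l + f v"
      using assms(1) by (auto simp: additively_homogeneous_def)
    ultimately show ?thesis by (simp add: sum_distrib_left mult.commute)
  qed
  from this[of 1] this[of "-1"] show ?thesis by simp
qed

lemma convex_subgradient_exists:
  fixes g :: "real^'n \<Rightarrow> real"
  assumes "convex_on UNIV g"
  shows "\<exists>p. \<forall>x. p \<bullet> (x - w) \<le> g x - g w"
proof -
  define S where "S = {z. g (fst z) < snd z}"
  have "convex S"
  proof (rule convexI)
    fix y z and s t :: real
    assume *: "y \<in> S" "z \<in> S" "0 \<le> s" "0 \<le> t" "s + t = 1"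
    have "g (s *\<^sub>R fst y + t *\<^sub>R fst z) \<le> s * g (fst y) + t * g (fst z)"
      using assms * by (simp add: convex_on_def)
    also have "\<dots> < s * snd y + t * snd z"
    proof (cases "s = 0")
      case True
      then show ?thesis using * by (simp add: S_def)
    next
      case False
      then show ?thesis using * unfolding S_def
        by (intro add_less_le_mono) (auto intro: mult_left_mono)
    qed
    finally show "s *\<^sub>R y + t *\<^sub>R z \<in> S" by (simp add: S_def)
  qed
  moreover have "(w, g w + 1) \<in> S" by (simp add: S_def)
  moreover have "S \<inter> {(w, g w)} = {}" by (auto simp: S_def)
  ultimately obtain a b where ab: "a \<noteq> 0" "\<forall>z\<in>S. a \<bullet> z \<le> b" "\<forall>z\<in>{(w, g w)}. a \<bullet> z \<ge> b"
    using separating_hyperplane_sets[of S "{(w, g w)}"] by blast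
  obtain q \<alpha> where a: "a = (q, \<alpha>)" by (cases a)
  have sep: "q \<bullet> x + \<alpha> * t \<le> q \<bullet> w + \<alpha> * g w" if "g x < t" for x t
  proof -
    have "a \<bullet> (x, t) \<le> b" using ab(2) that by (auto simp: S_def)
    also have "b \<le> a \<bullet> (w, g w)" using ab(3) by simp
    finally show ?thesis by (simp add: a)
  qed
  have "\<alpha> \<le> 0" using sep[of w "g w + 1"] by (simp add: algebra_simps)
  moreover have "\<alpha> \<noteq> 0"
  proof
    assume "\<alpha> = 0"
    then have "q \<bullet> q \<le> 0" using sep[of "w + q" "g (w + q) + 1"] by (simp add: inner_add_right)
    then have "q = 0" using inner_ge_zero[of q] by (simp del: inner_ge_zero)
    with \<open>\<alpha> = 0\<close> ab(1) show False by (simp add: a zero_prod_def)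
  qed
  ultimately have \<alpha>: "\<alpha> < 0" by simp
  have "(q /\<^sub>R (- \<alpha>)) \<bullet> (x - w) \<le> g x - g w" for x
  proof -
    have "q \<bullet> (x - w) / (- \<alpha>) + g w \<le> t" if "g x < t" for t
    proof -
      have "q \<bullet> (x - w) \<le> (- \<alpha>) * (t - g w)"
        using sep[OF that] by (simp add: algebra_simps inner_diff_right)
      then have "q \<bullet> (x - w) / (- \<alpha>) \<le> t - g w"
        using \<alpha> by (subst pos_divide_le_eq) (auto simp: mult.commute)
      then show ?thesis by simp
    qed
    then have "q \<bullet> (x - w) / (- \<alpha>) + g w \<le> g x" by (rule dense_ge)
    then show ?thesis by (simp add: divide_inverse mult.commute)
  qed
  then show ?thesis by blast
qed

lemma subdifferential_extend:
  assumes "convex_map f"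
    and "\<And>i x. i \<in> F \<Longrightarrow> (\<Sum>j\<in>UNIV. P $ i $ j * (x $ j - w $ j)) \<le> f x $ i - f w $ i"
  obtains Q where "Q \<in> subdifferential f w" "\<And>i. i \<in> F \<Longrightarrow> Q $ i = P $ i"
proof -
  have "\<forall>i. \<exists>p. \<forall>x. p \<bullet> (x - w) \<le> f x $ i - f w $ i"
    using assms(1) convex_subgradient_exists[of "\<lambda>x. f x $ _" w] unfolding convex_map_def by blast
  then obtain p where p: "\<And>i x. p i \<bullet> (x - w) \<le> f x $ i - f w $ i" by metis
  define Q where "Q = (\<chi> i. if i \<in> F then P $ i else p i)"
  have "Q \<in> subdifferential f w"
    unfolding subdifferential_iff
  proof (intro allI)
    fix x i
    show "(\<Sum>j\<in>UNIV. Q $ i $ j * (x $ j - w $ j)) \<le> f x $ i - f w $ i"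
      using assms(2)[of i x] p[of i x] by (cases "i \<in> F") (simp_all add: Q_def inner_vec_def)
  qed
  then show ?thesis by (rule that) (simp add: Q_def)
qed

lemma eigenvalue_le:
  fixes f :: "real^'n \<Rightarrow> real^'n"
  assumes "mono f" "additively_homogeneous f" "f v = vec l + v" "f w = vec m + w"
  shows "l \<le> m"
proof -
  define M where "M = Max (range (\<lambda>i. v $ i - w $ i))"
  have "M \<in> range (\<lambda>i. v $ i - w $ i)" unfolding M_def by (rule Max_in) auto
  then obtain i where i: "M = v $ i - w $ i" by auto
  have "v $ j - w $ j \<le> M" for j unfolding M_def by (rule Max_ge) auto
  then have "v \<le> vec M + w" by (auto simp: less_eq_vec_def algebra_simps)
  then have "f v \<le> f (vec M + w)" by (rule monoD[OF assms(1)])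
  also have "\<dots> = vec M + f w" using assms(2) by (auto simp: additively_homogeneous_def)
  finally have "f v \<le> vec M + f w" .
  then have "f v $ i \<le> M + f w $ i" by (simp add: less_eq_vec_def)
  then show ?thesis using i assms(3,4) by simp
qed

lemma reachable_matrix_graph:
  fixes P :: "real^'n^'n"
  shows "u \<rightarrow>\<^sup>*\<^bsub>matrix_graph P\<^esub> w \<longleftrightarrow> (u, w) \<in> {(i, j). P $ i $ j \<noteq> 0}\<^sup>*"
proof -
  have "(u, w) \<in> rtrancl_on UNIV R" if "(u, w) \<in> R\<^sup>*" for R :: "('n \<times> 'n) set"
    using that by induction (auto intro: rtrancl_on_into_rtrancl_on)
  then show ?thesis
    using rtrancl_on_rtranclI[of u w UNIV] by (auto simp: reachable_def matrix_graph_def)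
qed

lemma final_classes_matrix_graph:
  "C \<in> final_classes (matrix_graph P) \<longleftrightarrow>
     C \<noteq> {} \<and> (\<forall>u\<in>C. {w. (u, w) \<in> {(i, j). P $ i $ j \<noteq> 0}\<^sup>*} = C)"
  unfolding final_classes_def pre_digraph.sccs_verts_def reachable_matrix_graph by blast

lemma final_class_transfer:
  assumes "C \<in> final_classes (matrix_graph P)" "\<And>i. i \<in> C \<Longrightarrow> Q $ i = P $ i"
  shows "C \<in> final_classes (matrix_graph Q)"
proof -
  let ?R = "\<lambda>P. {(i, j). P $ i $ j \<noteq> 0}"
  have closed: "j \<in> C" if "i \<in> C" "P $ i $ j \<noteq> 0" for i j
    using assms(1) that unfolding final_classes_matrix_graph by blast
  have "(u, w) \<in> (?R P)\<^sup>* \<longleftrightarrow> (u, w) \<in> (?R Q)\<^sup>*" if "u \<in> C" for u w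
  proof
    assume "(u, w) \<in> (?R P)\<^sup>*"
    then have "w \<in> C \<and> (u, w) \<in> (?R Q)\<^sup>*"
    proof induction
      case (step y z)
      then have "(y, z) \<in> ?R Q" "z \<in> C" using assms(2)[of y] closed[of y z] by auto
      then show ?case using step by (meson rtrancl.rtrancl_into_rtrancl)
    qed (use that in auto)
    then show "(u, w) \<in> (?R Q)\<^sup>*" by simp
  next
    assume "(u, w) \<in> (?R Q)\<^sup>*"
    then have "w \<in> C \<and> (u, w) \<in> (?R P)\<^sup>*"
    proof induction
      case (step y z)
      then have "(y, z) \<in> ?R P" "z \<in> C" using assms(2)[of y] closed[of y z] by auto
      then show ?case using step by (meson rtrancl.rtrancl_into_rtrancl)
    qed (use that in auto)
    then show "(u, w) \<in> (?R P)\<^sup>*" by simp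
  qed
  then show ?thesis using assms(1) unfolding final_classes_matrix_graph by auto
qed

lemma verts_final_graph: "verts (final_graph P) = \<Union> (final_classes (matrix_graph P))"
  by (simp add: final_graph_def)

lemma arcs_final_graph:
  "arcs (final_graph P) = {(i, j). P $ i $ j \<noteq> 0 \<and> i \<in> verts (final_graph P)}"
proof -
  define V where "V = verts (final_graph P)"
  have closed: "j \<in> V" if ij: "i \<in> V" "P $ i $ j \<noteq> 0" for i j
  proof -
    obtain C where C: "C \<in> final_classes (matrix_graph P)" "i \<in> C"
      using ij(1) unfolding V_def verts_final_graph by blast
    then have "j \<in> C" using ij(2) unfolding final_classes_matrix_graph by blast
    then show ?thesis using C(1) unfolding V_def verts_final_graph by blast
  qed
  have "arcs (final_graph P) = arcs (matrix_graph P \<restriction> V)"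
    by (simp add: V_def final_graph_def)
  also have "\<dots> = {(i, j). P $ i $ j \<noteq> 0 \<and> i \<in> V \<and> j \<in> V}"
    by (auto simp: matrix_graph_def)
  also have "\<dots> = {(i, j). P $ i $ j \<noteq> 0 \<and> i \<in> V}" using closed by blast
  finally show ?thesis by (simp add: V_def)
qed

lemma final_class_subgradient:
  fixes f :: "real^'n \<Rightarrow> real^'n"
  assumes f: "mono f" "additively_homogeneous f" "convex_map f"
    and ev: "eigenvector f v" "eigenvector f w"
    and P: "P \<in> subdifferential f v" and C: "C \<in> final_classes (matrix_graph P)"
  obtains Q where "Q \<in> subdifferential f w" "C \<in> final_classes (matrix_graph Q)"
    "\<And>i. i \<in> C \<Longrightarrow> Q $ i = P $ i"
proof -
  obtain l m where "f v = vec l + v" "f w = vec m + w"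
    using ev unfolding eigenvector_def by blast
  moreover have "l = m"
    using eigenvalue_le[OF f(1,2) calculation] eigenvalue_le[OF f(1,2) calculation(2,1)] by simp
  ultimately have l: "f v = vec l + v" "f w = vec l + w" by auto
  define u where "u i = w $ i - v $ i" for i
  have sub: "(\<Sum>j\<in>UNIV. P $ i $ j * u j) \<le> u i" for i
  proof -
    have "(\<Sum>j\<in>UNIV. P $ i $ j * (w $ j - v $ j)) \<le> f w $ i - f v $ i"
      using P unfolding subdifferential_iff by blast
    then show ?thesis by (simp add: l u_def)
  qed
  have "finite C" by simp
  have "C \<noteq> {}" using C unfolding final_classes_matrix_graph by blast
  have closed: "j \<in> C" if "i \<in> C" "P $ i $ j \<noteq> 0" for i j
    using C that unfolding final_classes_matrix_graph by blast
  obtain c where c: "c \<in> C" "\<And>i. i \<in> C \<Longrightarrow> u c \<le> u i"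
    using \<open>C \<noteq> {}\<close> \<open>finite C\<close> by (metis arg_min_if_finite(1) arg_min_least)
  have const_step: "u j = u c" if "i \<in> C" "u i = u c" "P $ i $ j \<noteq> 0" for i j
  proof -
    have nonneg: "0 \<le> P $ i $ k * (u k - u c)" for k
      using subdifferential_nonneg[OF f(1) P, of i k] closed[OF \<open>i \<in> C\<close>, of k] c(2)[of k]
      by (cases "P $ i $ k = 0") auto
    have "(\<Sum>k\<in>UNIV. P $ i $ k * (u k - u c)) = (\<Sum>k\<in>UNIV. P $ i $ k * u k) - u c"
      using subdifferential_row_sum[OF f(2) P, of i]
      by (simp add: right_diff_distrib sum_subtractf flip: sum_distrib_right)
    then have "(\<Sum>k\<in>UNIV. P $ i $ k * (u k - u c)) = 0"
      using sub[of i] that(2) sum_nonneg[of UNIV "\<lambda>k. P $ i $ k * (u k - u c)"] nonneg by simp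
    then have "P $ i $ j * (u j - u c) = 0"
      using nonneg sum_nonneg_eq_0_iff[of UNIV "\<lambda>k. P $ i $ k * (u k - u c)"] by simp
    then show ?thesis using that(3) by simp
  qed
  have const: "u i = u c" if "i \<in> C" for i
  proof -
    have "(c, i) \<in> {(i, j). P $ i $ j \<noteq> 0}\<^sup>*"
      using C c(1) that unfolding final_classes_matrix_graph by blast
    then have "i \<in> C \<and> u i = u c"
    proof induction
      case (step y z)
      then show ?case using closed[of y z] const_step[of y z] by simp
    qed (simp add: c(1))
    then show ?thesis by simp
  qed
  have "(\<Sum>j\<in>UNIV. P $ i $ j * (x $ j - w $ j)) \<le> f x $ i - f w $ i" if "i \<in> C" for i x
  proof -
    have "(\<Sum>j\<in>UNIV. P $ i $ j * u j) = (\<Sum>j\<in>UNIV. P $ i $ j * u c)"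
      by (rule sum.cong) (use const closed that in auto)
    also have "\<dots> = u i"
      using subdifferential_row_sum[OF f(2) P, of i] const[OF that] by (simp flip: sum_distrib_right)
    finally have "(\<Sum>j\<in>UNIV. P $ i $ j * (x $ j - w $ j)) + u i
        = (\<Sum>j\<in>UNIV. P $ i $ j * (x $ j - v $ j))"
      by (simp add: u_def algebra_simps sum_subtractf)
    also have "\<dots> \<le> f x $ i - f v $ i" using P unfolding subdifferential_iff by blast
    finally show ?thesis using l by (simp add: u_def)
  qed
  from subdifferential_extend[OF f(3) this]
  obtain Q where Q: "Q \<in> subdifferential f w" "\<And>i. i \<in> C \<Longrightarrow> Q $ i = P $ i" by blast
  show ?thesis by (rule that[OF Q(1) final_class_transfer[OF C Q(2)] Q(2)])
qed

lemma critical_graph_at_eq: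
  fixes f :: "real^'n \<Rightarrow> real^'n"
  assumes f: "mono f" "additively_homogeneous f" "convex_map f"
    and ev: "eigenvector f v" "eigenvector f w"
  shows "critical_graph_at f v = critical_graph_at f w"
proof -
  have sub: "(\<Union>P \<in> subdifferential f v. verts (final_graph P))
        \<subseteq> (\<Union>P \<in> subdifferential f w. verts (final_graph P))"
       "(\<Union>P \<in> subdifferential f v. arcs (final_graph P))
        \<subseteq> (\<Union>P \<in> subdifferential f w. arcs (final_graph P))"
    if ev': "eigenvector f v" "eigenvector f w" for v w
  proof -
    show "(\<Union>P \<in> subdifferential f v. verts (final_graph P))
        \<subseteq> (\<Union>P \<in> subdifferential f w. verts (final_graph P))"
      using final_class_subgradient[OF f ev'] unfolding verts_final_graph by (smt (verit) UN_iff Union_iff subsetI)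
    show "(\<Union>P \<in> subdifferential f v. arcs (final_graph P))
        \<subseteq> (\<Union>P \<in> subdifferential f w. arcs (final_graph P))"
    proof
      fix e assume "e \<in> (\<Union>P \<in> subdifferential f v. arcs (final_graph P))"
      then obtain P i j C where *: "e = (i, j)" "P \<in> subdifferential f v" "P $ i $ j \<noteq> 0"
          "C \<in> final_classes (matrix_graph P)" "i \<in> C"
        by (auto simp: arcs_final_graph verts_final_graph)
      then obtain Q where "Q \<in> subdifferential f w" "C \<in> final_classes (matrix_graph Q)" "Q $ i = P $ i"
        using final_class_subgradient[OF f ev' *(2,4)] by metis
      then show "e \<in> (\<Union>P \<in> subdifferential f w. arcs (final_graph P))"
        using * by (intro UN_I[of Q]) (auto simp: arcs_final_graph verts_final_graph)
    qed
  qed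
  show ?thesis
    unfolding critical_graph_at_def
      equalityI[OF sub(1)[OF ev] sub(1)[OF ev(2,1)]] equalityI[OF sub(2)[OF ev] sub(2)[OF ev(2,1)]]
    by (rule refl)
qed

lemma critical_graph_eq:
  assumes "mono f" "additively_homogeneous f" "convex_map f" "eigenvector f v"
  shows "critical_graph f = critical_graph_at f v"
  unfolding critical_graph_def
  using critical_graph_at_eq[OF assms(1-3) _ assms(4)] someI[of "eigenvector f" v] assms(4) by blast

end

theory Submission
  imports Defs
begin

text \<open>
  Let \<open>U\<close> be the periodic orbit, \<open>v\<close> a fixed point (the limit of the iterates of \<open>sup U\<close>) and \<open>N\<close> the
  cyclicity. By the minimum principle, the subgradient inequality at \<open>v\<close> is an equality along
  critical arcs, \<open>(f u - v)\<^sub>i = (u - v)\<^sub>j\<close>, so every circuit length of a critical component is a period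
  of the orbit in the coordinates of that component, and hence so is \<open>N\<close>. For the other coordinates,
  the places where \<open>f\<^sup>N u - u\<close> is minimal are closed under the subgradients at the points of the orbit;
  on a final class of those, \<open>v - u\<close> is constant, which turns these subgradients into subgradients at
  \<open>v\<close>. So the minimum is attained at a critical node and is \<open>0\<close>, i.e. \<open>x \<le> f\<^sup>N x\<close>; iterating
  around the orbit gives equality.
\<close>

section \<open>The minimum principle on a finite digraph\<close>

lemma finite_min_exists:
  fixes h :: "'a \<Rightarrow> 'b::linorder"
  assumes "finite A" "A \<noteq> {}"
  obtains m where "m \<in> A" "\<And>r. r \<in> A \<Longrightarrow> h m \<le> h r"
  using arg_min_if_finite(1)[OF assms, of h] arg_min_least[OF assms, of _ h] by blast

text \<open>Take \<open>s\<close> in \<open>I\<close> with the fewest reachable states. Whatever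
  \<open>s\<close> reaches can reach only a subset of these, hence by minimality all of them,
  \<open>s\<close> included.\<close>

lemma final_state_exists:
  assumes "finite I" "I \<noteq> {}" and closed: "\<And>s t. s \<in> I \<Longrightarrow> (s, t) \<in> E \<Longrightarrow> t \<in> I"
  obtains s where "s \<in> I" "E\<^sup>* `` {s} \<subseteq> I" "\<And>t. (s, t) \<in> E\<^sup>* \<Longrightarrow> (t, s) \<in> E\<^sup>*"
proof -
  have reach: "E\<^sup>* `` {s} \<subseteq> I" if "s \<in> I" for s
  proof -
    have "t \<in> I" if "(s, t) \<in> E\<^sup>*" for t
      using that by induction (use \<open>s \<in> I\<close> closed in auto)
    then show ?thesis by blast
  qed
  obtain s where s: "s \<in> I" "\<And>t. t \<in> I \<Longrightarrow> card (E\<^sup>* `` {s}) \<le> card (E\<^sup>* `` {t})"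
    using finite_min_exists[OF assms(1,2), of "\<lambda>s. card (E\<^sup>* `` {s})"] by blast
  have "(t, s) \<in> E\<^sup>*" if "(s, t) \<in> E\<^sup>*" for t
  proof -
    have sub: "E\<^sup>* `` {t} \<subseteq> E\<^sup>* `` {s}" using that by (auto intro: rtrancl_trans)
    have "t \<in> I" using reach[OF s(1)] that by blast
    then have "E\<^sup>* `` {t} = E\<^sup>* `` {s}"
      using card_seteq[OF finite_subset[OF reach[OF s(1)] assms(1)] sub s(2)] by simp
    then show ?thesis by blast
  qed
  with s(1) reach[OF s(1)] show ?thesis by (rule that)
qed

text \<open>Hypothesis \<open>loc\<close> says that a local minimum of \<open>h\<close> shares its
  value with its successors. Starting from a global minimum over the states reachable from
  \<open>s\<close>, this value spreads along the arcs, and recurrence makes it arrive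
  everywhere.\<close>

lemma recurrent_const:
  fixes h :: "'s \<Rightarrow> real"
  assumes fin: "finite (E\<^sup>* `` {s})"
    and rec: "\<And>t. (s, t) \<in> E\<^sup>* \<Longrightarrow> (t, s) \<in> E\<^sup>*"
    and loc: "\<And>t t'. (\<And>r. (t, r) \<in> E \<Longrightarrow> h t \<le> h r) \<Longrightarrow> (t, t') \<in> E \<Longrightarrow> h t' = h t"
    and t: "(s, t) \<in> E\<^sup>*"
  shows "h t = h s"
proof -
  have "E\<^sup>* `` {s} \<noteq> {}" by blast
  then obtain m where m: "(s, m) \<in> E\<^sup>*" "\<And>r. (s, r) \<in> E\<^sup>* \<Longrightarrow> h m \<le> h r"
    using finite_min_exists[OF fin \<open>E\<^sup>* `` {s} \<noteq> {}\<close>, of h] unfolding Image_singleton_iff by metis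
  have min: "h r = h m" if "(s, r) \<in> E\<^sup>*" for r
  proof -
    have "(m, r) \<in> E\<^sup>*" using rec[OF m(1)] that by (rule rtrancl_trans)
    then show ?thesis
    proof induction
      case (step y z)
      have "(s, y) \<in> E\<^sup>*" using m(1) step(1) by (rule rtrancl_trans)
      then have "h y \<le> h r" if "(y, r) \<in> E" for r
        using m(2)[of r] that step.IH by (auto intro: rtrancl_into_rtrancl)
      then show ?case using loc[of y z] step by simp
    qed simp
  qed
  show ?thesis using min[OF t] min[of s] by simp
qed

text \<open>The equality case of averaging: the terms \<open>p k * (h k - m)\<close> are nonnegative
  and their sum is at most 0, so each of them vanishes.\<close>

lemma weighted_mean_le_min:
  fixes p h :: "'n::finite \<Rightarrow> real"
  assumes "\<And>j. 0 \<le> p j" "(\<Sum>j\<in>UNIV. p j) = 1" "(\<Sum>j\<in>UNIV. p j * h j) \<le> m"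
    and "\<And>j. p j \<noteq> 0 \<Longrightarrow> m \<le> h j" "p j \<noteq> 0"
  shows "h j = m"
proof -
  have nonneg: "0 \<le> p k * (h k - m)" for k
    using assms(1)[of k] assms(4)[of k] by (cases "p k = 0") auto
  have "(\<Sum>k\<in>UNIV. p k * (h k - m)) = (\<Sum>k\<in>UNIV. p k * h k) - m"
    using assms(2) by (simp add: right_diff_distrib sum_subtractf flip: sum_distrib_right)
  then have "(\<Sum>k\<in>UNIV. p k * (h k - m)) = 0"
    using assms(3) sum_nonneg[of UNIV "\<lambda>k. p k * (h k - m)"] nonneg by simp
  then have "p j * (h j - m) = 0"
    using nonneg sum_nonneg_eq_0_iff[of UNIV "\<lambda>k. p k * (h k - m)"] by simp
  then show ?thesis using assms(5) by simp
qed

section \<open>Periods\<close>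

text \<open>By division with remainder, the least positive element of \<open>T\<close> divides every
  element of \<open>T\<close>, hence also \<open>Gcd L\<close>, which is therefore a multiple of it.
  This is to be applied to a set \<open>T\<close> of periods.\<close>

lemma Gcd_mem_closed:
  fixes T :: "nat set"
  assumes "0 \<in> T" and add: "\<And>a b. a \<in> T \<Longrightarrow> b \<in> T \<Longrightarrow> a + b \<in> T"
    and diff: "\<And>a b. a \<in> T \<Longrightarrow> b \<in> T \<Longrightarrow> a - b \<in> T" and "L \<subseteq> T"
  shows "Gcd L \<in> T"
proof (cases "L \<subseteq> {0}")
  case True
  then have "Gcd L = 0" by simp
  then show ?thesis using assms(1) by metis
next
  case False
  have mult: "k * a \<in> T" if "a \<in> T" for a k
    by (induction k) (use assms(1) add that in auto)
  define g where "g = (LEAST a. a \<in> T \<and> 0 < a)"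
  obtain a where "a \<in> L" "a \<noteq> 0" using False by auto
  then have "a \<in> T \<and> 0 < a" using assms(4) by auto
  then have "g \<in> T \<and> 0 < g" unfolding g_def by (rule LeastI)
  then have g: "g \<in> T" "0 < g" by auto
  have "g dvd a" if "a \<in> T" for a
  proof -
    have "a - (a div g) * g \<in> T" using diff[OF that mult[OF g(1)]] .
    then have "a mod g \<in> T" by (simp add: minus_div_mult_eq_mod)
    moreover have "a mod g < g" using g(2) by simp
    ultimately have "a mod g = 0" 
      using not_less_Least[of "a mod g" "\<lambda>a. a \<in> T \<and> 0 < a"] by (simp add: g_def[symmetric])
    then show ?thesis by auto
  qed
  then have "g dvd Gcd L" using assms(4) by (auto intro: Gcd_greatest)
  then obtain k where "Gcd L = g * k" by blast
  then show ?thesis using mult[OF g(1), of k] by (simp add: mult.commute)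
qed

lemma funpow_mult_fixed:
  assumes "(f ^^ c) u = u"
  shows "(f ^^ (c * k)) u = u"
  by (induction k) (use assms in \<open>auto simp: funpow_add\<close>)

section \<open>Finite sets of periodic points of convex monotone homogeneous maps\<close>

text \<open>
  A backward step \<open>f u \<rightarrow> u\<close> in time goes along with an arc of \<open>p u\<close>: this is the direction
  in which the subgradient inequality \<open>f z - f u \<ge> p u (z - u)\<close> transports information.
\<close>
definition orbit_arcs ::
    "(real^'n \<Rightarrow> real^'n) \<Rightarrow> (real^'n) set \<Rightarrow> (real^'n \<Rightarrow> real^'n^'n) \<Rightarrow>
      (((real^'n) \<times> 'n) \<times> ((real^'n) \<times> 'n)) set" where
  "orbit_arcs f U p = {((f u, i), (u, j)) | u i j. u \<in> U \<and> p u $ i $ j \<noteq> 0}"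

locale periodic_points =
  fixes f :: "real^'n \<Rightarrow> real^'n" and U :: "(real^'n) set" and c :: nat
  assumes convex: "convex_map f" and mono: "mono f" and hom: "additively_homogeneous f"
    and finite_U: "finite U" and closed: "u \<in> U \<Longrightarrow> f u \<in> U"
    and c: "1 \<le> c" and periodic: "u \<in> U \<Longrightarrow> (f ^^ c) u = u"
begin

section \<open>Iteration on a periodic set and existence of a fixed point\<close>

lemma funpow_closed: "u \<in> U \<Longrightarrow> (f ^^ k) u \<in> U"
  by (induction k) (auto intro: closed)

text \<open>On \<open>U\<close> the map \<open>f ^^ c\<close> is the identity, so
  \<open>f ^^ ((c - 1) * k)\<close> inverts \<open>f ^^ k\<close>.\<close>

lemma preimage_funpow:
  assumes "u \<in> U"
  obtains w where "w \<in> U" "(f ^^ k) w = u"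
proof
  show "(f ^^ ((c - 1) * k)) u \<in> U" using assms by (rule funpow_closed)
  have "k + (c - 1) * k = c * k" using c by (cases c) auto
  then have "(f ^^ k) ((f ^^ ((c - 1) * k)) u) = (f ^^ (c * k)) u"
    by (simp flip: funpow_add add: comp_apply[symmetric, of "f ^^ k"] del: comp_apply)
  then show "(f ^^ k) ((f ^^ ((c - 1) * k)) u) = u"
    using funpow_mult_fixed[OF periodic[OF assms]] by simp
qed

lemma add_const: "f (vec l + u) = vec l + f u"
  using hom by (auto simp: additively_homogeneous_def)

lemma funpow_add_const: "(f ^^ k) (vec l + u) = vec l + (f ^^ k) u"
  by (induction k) (auto simp: add_const)

lemma funpow_mono: "u \<le> w \<Longrightarrow> (f ^^ k) u \<le> (f ^^ k) w"
  by (induction k) (auto intro: monoD[OF mono])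

lemma continuous: "isCont f u"
proof -
  have "continuous_on UNIV (\<lambda>x. f x $ i)" for i
    using convex by (intro convex_on_continuous) (auto simp: convex_map_def)
  then have "continuous_on UNIV (\<lambda>x. \<chi> i. f x $ i)" by (rule continuous_on_vec_lambda)
  then show ?thesis by (simp add: continuous_on_eq_continuous_at)
qed

lemma fixed_point_exists:
  assumes "U \<noteq> {}"
  obtains v where "f v = v"
proof -
  obtain u0 where u0: "u0 \<in> U" using assms by blast
  define m where "m = (\<chi> i. Max ((\<lambda>u. u $ i) ` U))"
  have le_m: "u \<le> m" if "u \<in> U" for u
    using that finite_U by (auto simp: m_def less_eq_vec_def)
  have "u \<le> f m" if u: "u \<in> U" for u
  proof -
    obtain w where "w \<in> U" "(f ^^ 1) w = u" using u by (rule preimage_funpow)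
    then show ?thesis using monoD[OF mono le_m, of w] by simp
  qed
  then have m_le: "m \<le> f m"
    using finite_U assms by (auto simp: m_def less_eq_vec_def)
  \<comment> \<open>Raising \<open>u0\<close> by \<open>K\<close> puts it above \<open>m\<close>. By
    homogeneity the whole orbit of \<open>u0\<close> is raised by \<open>K\<close>, and since that
    orbit stays below \<open>m\<close>, the iterates of \<open>m\<close> stay below
    \<open>vec K + m\<close>.\<close>
  define K where "K = Max (range (\<lambda>i. m $ i - u0 $ i))"
  have "m $ i - u0 $ i \<le> K" for i unfolding K_def by (rule Max_ge) auto
  then have "m \<le> vec K + u0" by (auto simp: less_eq_vec_def algebra_simps)
  have bound: "(f ^^ k) m \<le> vec K + m" for k
  proof -
    have "(f ^^ k) m \<le> vec K + (f ^^ k) u0"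
      using funpow_mono[OF \<open>m \<le> vec K + u0\<close>] by (simp add: funpow_add_const)
    also have "\<dots> \<le> vec K + m"
      using le_m[OF funpow_closed[OF u0]] by simp
    finally show ?thesis .
  qed
  have step: "(f ^^ k) m \<le> (f ^^ Suc k) m" for k
    using funpow_mono[OF m_le, of k] by (simp add: funpow_swap1)
  have "convergent (\<lambda>k. (f ^^ k) m $ i)" for i
  proof (rule Bseq_mono_convergent)
    show inc: "\<forall>k l. k \<le> l \<longrightarrow> (f ^^ k) m $ i \<le> (f ^^ l) m $ i"
    proof (intro allI impI)
      show "(f ^^ k) m $ i \<le> (f ^^ l) m $ i" if "k \<le> l" for k l
        using _ that by (rule lift_Suc_mono_le) (use step in \<open>simp add: less_eq_vec_def\<close>)
    qed
    show "Bseq (\<lambda>k. (f ^^ k) m $ i)"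
    proof (rule BseqI')
      fix k :: nat
      have "m $ i \<le> (f ^^ k) m $ i" using inc[rule_format, of 0 k] by simp
      moreover have "(f ^^ k) m $ i \<le> K + m $ i" using bound[of k] by (simp add: less_eq_vec_def)
      ultimately show "norm ((f ^^ k) m $ i) \<le> \<bar>m $ i\<bar> + \<bar>K + m $ i\<bar>" by (simp add: abs_if)
    qed
  qed
  then obtain l where "\<And>i. (\<lambda>k. (f ^^ k) m $ i) \<longlonglongrightarrow> l i" unfolding convergent_def by metis
  then have lim: "(\<lambda>k. (f ^^ k) m) \<longlonglongrightarrow> (\<chi> i. l i)" by (intro vec_tendstoI) simp
  then have "(\<lambda>k. f ((f ^^ k) m)) \<longlonglongrightarrow> f (\<chi> i. l i)" by (rule isCont_tendsto_compose[OF continuous])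
  moreover have "(\<lambda>k. f ((f ^^ k) m)) \<longlonglongrightarrow> (\<chi> i. l i)"
    using LIMSEQ_Suc[OF lim] by simp
  ultimately show ?thesis using that LIMSEQ_unique by blast
qed

section \<open>Transport along critical arcs and the periods of critical coordinates\<close>

lemma orbit_arcs_reach_subset: "(orbit_arcs f U p)\<^sup>* `` {s} \<subseteq> insert s (U \<times> UNIV)"
proof -
  have "t \<in> insert s (U \<times> UNIV)" if "(s, t) \<in> (orbit_arcs f U p)\<^sup>*" for t
    using that by induction (auto simp: orbit_arcs_def)
  then show ?thesis by blast
qed

text \<open>The rows of the \<open>p u\<close> are transition probabilities on
  \<open>orbit_arcs\<close>, and \<open>h\<close> is superharmonic for them. The base points
  \<open>q u\<close> are left free because the lemma serves both for one subgradient at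
  \<open>v\<close> and for subgradients at the orbit points.\<close>

lemma superharmonic_const:
  assumes "\<And>u. u \<in> U \<Longrightarrow> p u \<in> subdifferential f (q u)"
    and "\<And>u i. u \<in> U \<Longrightarrow> (\<Sum>j\<in>UNIV. p u $ i $ j * h (u, j)) \<le> h (f u, i)"
    and rec: "\<And>t. (s, t) \<in> (orbit_arcs f U p)\<^sup>* \<Longrightarrow> (t, s) \<in> (orbit_arcs f U p)\<^sup>*"
    and t: "(s, t) \<in> (orbit_arcs f U p)\<^sup>*"
  shows "h t = (h s :: real)"
proof (rule recurrent_const[OF _ rec _ t])
  show "finite ((orbit_arcs f U p)\<^sup>* `` {s})"
    using orbit_arcs_reach_subset by (rule finite_subset) (simp add: finite_U)
next
  fix t t'
  assume min: "\<And>r. (t, r) \<in> orbit_arcs f U p \<Longrightarrow> h t \<le> h r" and "(t, t') \<in> orbit_arcs f U p"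
  then obtain u i j where *: "t = (f u, i)" "t' = (u, j)" "u \<in> U" "p u $ i $ j \<noteq> 0"
    by (auto simp: orbit_arcs_def)
  have "h (u, k) \<ge> h t" if "p u $ i $ k \<noteq> 0" for k
    using * that by (intro min) (auto simp: orbit_arcs_def)
  then show "h t' = h t"
    using weighted_mean_le_min[of "\<lambda>j. p u $ i $ j" "\<lambda>j. h (u, j)" "h t" j] assms(2)[OF *(3), of i]
      subdifferential_nonneg[OF mono assms(1)[OF *(3)]]
      subdifferential_row_sum[OF hom assms(1)[OF *(3)]] * by simp
qed

text \<open>The subgradient inequality at \<open>v\<close> makes \<open>u $ i - v $ i\<close>
  superharmonic on pairs of an orbit point and a coordinate. What remains is recurrence: a return in
  the graph of \<open>P\<close> must also return to the same orbit point.\<close>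

lemma critical_arc_transport:
  assumes v: "f v = v" and P: "P \<in> subdifferential f v"
    and C: "C \<in> final_classes (matrix_graph P)" "i \<in> C" and ij: "P $ i $ j \<noteq> 0"
    and u: "u \<in> U"
  shows "f u $ i - v $ i = u $ j - v $ j"
proof -
  let ?E = "orbit_arcs f U (\<lambda>_. P)" and ?R = "{(i, j). P $ i $ j \<noteq> 0}"
  \<comment> \<open>A walk of length \<open>t\<close> in the graph of \<open>P\<close> lifts to a
    walk going back \<open>t\<close> steps in time; \<open>forward\<close> is the converse
    projection.\<close>
  have backward: "(((f ^^ t) w, a), (w, b)) \<in> ?E\<^sup>*" if "(a, b) \<in> ?R ^^ t" "w \<in> U" for a b w t
    using that
  proof (induction t arbitrary: b w)
    case (Suc t)
    then obtain d where d: "(a, d) \<in> ?R ^^ t" "P $ d $ b \<noteq> 0" by auto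
    have "(((f ^^ t) (f w), a), (f w, d)) \<in> ?E\<^sup>*" using Suc.IH[OF d(1) closed[OF Suc.prems(2)]] .
    moreover have "((f w, d), (w, b)) \<in> ?E" using d(2) Suc.prems(2) by (auto simp: orbit_arcs_def)
    ultimately show ?case by (simp add: funpow_swap1)
  qed simp
  have forward: "\<exists>t. y = (f ^^ t) (fst r) \<and> (i, snd r) \<in> ?R ^^ t \<and> fst r \<in> U"
    if "((y, i), r) \<in> ?E\<^sup>*" "y \<in> U" for r y
    using that
  proof induction
    case base
    then show ?case by (auto intro: exI[of _ 0])
  next
    case (step r r')
    then obtain t where t: "y = (f ^^ t) (fst r)" "(i, snd r) \<in> ?R ^^ t" by auto
    have r: "fst r = f (fst r')" "(snd r, snd r') \<in> ?R" "fst r' \<in> U"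
      using step(2) by (auto simp: orbit_arcs_def)
    have "y = (f ^^ Suc t) (fst r')" using t(1) r(1) by (simp add: funpow_swap1)
    moreover have "(i, snd r') \<in> ?R ^^ Suc t" using t(2) r(2) by auto
    ultimately show ?case using r(3) by blast
  qed
  have rec: "(r, (f u, i)) \<in> ?E\<^sup>*" if r: "((f u, i), r) \<in> ?E\<^sup>*" for r
  proof -
    obtain t where t: "f u = (f ^^ t) (fst r)" "(i, snd r) \<in> ?R ^^ t" "fst r \<in> U"
      using forward[OF r closed[OF u]] by blast
    have "(snd r, i) \<in> ?R\<^sup>*"
      using C relpow_imp_rtrancl[OF t(2)] unfolding final_classes_matrix_graph by blast
    then obtain q where q: "(snd r, i) \<in> ?R ^^ q" using rtrancl_imp_relpow by blast
    \<comment> \<open>After returning to \<open>i\<close>, the circuit of length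
      \<open>t + q\<close> is run \<open>c - 1\<close> more times. The total length is then
      \<open>c * (t + q)\<close>, so the time component comes back as well.\<close>
    define e where "e = (c - 1) * (t + q)"
    have loop: "(i, i) \<in> ?R ^^ (n * (t + q))" for n
      by (induction n) (use t(2) q in \<open>auto simp: relpow_add\<close>)
    then have "(snd r, i) \<in> ?R ^^ (q + e)" using q unfolding relpow_add e_def by blast
    then have "(((f ^^ (q + e)) (f u), snd r), (f u, i)) \<in> ?E\<^sup>*" using backward closed[OF u] by blast
    moreover have "(f ^^ (q + e)) (f u) = fst r"
    proof -
      have "q + e + t = c * (t + q)" using c by (cases c) (auto simp: e_def)
      then have "(f ^^ (q + e)) (f u) = (f ^^ (c * (t + q))) (fst r)"
        unfolding t(1) by (metis comp_apply funpow_add)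
      then show ?thesis using funpow_mult_fixed[OF periodic[OF t(3)]] by simp
    qed
    ultimately show ?thesis by simp
  qed
  have "(\<lambda>(u, i). u $ i - v $ i) (u, j) = (\<lambda>(u, i). u $ i - v $ i) (f u, i)"
  proof (rule superharmonic_const[of "\<lambda>_. P" "\<lambda>_. v", OF P _ rec])
    fix w k
    show "(\<Sum>j\<in>UNIV. P $ k $ j * (case (w, j) of (u, i) \<Rightarrow> u $ i - v $ i))
            \<le> (case (f w, k) of (u, i) \<Rightarrow> u $ i - v $ i)"
      using P v by (simp add: subdifferential_iff)
    show "((f u, i), (u, j)) \<in> ?E\<^sup>*"
      by (rule r_into_rtrancl) (use ij u in \<open>auto simp: orbit_arcs_def\<close>)
  qed
  then show ?thesis by simp
qed

text \<open>Successive arcs may come from different subgradients at \<open>v\<close>; the transport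
  rule for single arcs does not mind.\<close>

lemma critical_walk_transport:
  assumes v: "f v = v" and "pre_digraph.awalk (critical_graph_at f v) i p j" and "u \<in> U"
  shows "(f ^^ length p) u $ i - v $ i = u $ j - v $ j"
proof -
  interpret wf_digraph "critical_graph_at f v" by (rule wf_critical_graph_at)
  show ?thesis using assms(2)
  proof (induction p arbitrary: i)
    case Nil
    then show ?case by (simp add: awalk_Nil_iff)
  next
    case (Cons e p)
    obtain a b where e: "e = (a, b)" by (cases e)
    have "tail (critical_graph_at f v) = fst" "head (critical_graph_at f v) = snd"
      by (simp_all add: critical_graph_at_def)
    then have "e \<in> arcs (critical_graph_at f v)" "i = a" "awalk b p j"
      using Cons.prems e by (simp_all add: awalk_Cons_iff)
    then obtain P where P: "P \<in> subdifferential f v" "(i, b) \<in> arcs (final_graph P)"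
      using e by (auto simp: critical_graph_at_def)
    then obtain C where "C \<in> final_classes (matrix_graph P)" "i \<in> C" "P $ i $ b \<noteq> 0"
      by (auto simp: arcs_final_graph verts_final_graph)
    then have "f ((f ^^ length p) u) $ i - v $ i = (f ^^ length p) u $ b - v $ b"
      using critical_arc_transport[OF v P(1)] funpow_closed[OF assms(3)] by blast
    then show ?case using Cons.IH[OF \<open>awalk b p j\<close>] by simp
  qed
qed

lemma cyclicity_period_critical:
  assumes v: "f v = v" and i: "i \<in> verts (critical_graph_at f v)" and u: "u \<in> U"
  shows "(f ^^ cyclicity f) u $ i = u $ i"
proof -
  let ?G = "critical_graph_at f v"
  interpret wf_digraph ?G by (rule wf_critical_graph_at)
  have "eigenvector f v" unfolding eigenvector_def by (rule exI[of _ 0]) (simp add: v)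
  then have G: "critical_graph f = ?G" by (rule critical_graph_eq[OF mono hom convex])
  \<comment> \<open>Asking for a period at all points of \<open>U\<close> at once lets periods be
    applied to shifted points, which gives closure under sums and differences.\<close>
  define T where "T = {l. \<forall>w\<in>U. (f ^^ l) w $ i = w $ i}"
  have T_add: "a + b \<in> T" if "a \<in> T" "b \<in> T" for a b
    using that funpow_closed by (auto simp: T_def funpow_add)
  have T_diff: "a - b \<in> T" if "a \<in> T" "b \<in> T" for a b
  proof (cases "b \<le> a")
    case True
    have "(f ^^ (a - b)) w $ i = w $ i" if w: "w \<in> U" for w
    proof -
      have "(f ^^ b) ((f ^^ (a - b)) w) = (f ^^ a) w"
        using True by (metis add_diff_inverse_nat comp_apply funpow_add linorder_not_less)
      then show ?thesis
        using \<open>a \<in> T\<close> \<open>b \<in> T\<close> w funpow_closed[OF w, where k = "a - b"] unfolding T_def by auto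
    qed
    then show ?thesis by (simp add: T_def)
  qed (simp add: T_def)
  obtain H where H: "H \<in> sccs" "verts H = scc_of i"
    using scc_of_in_sccs_verts[OF i] sccs_verts_conv by auto
  then have sub: "subgraph H ?G" by blast
  then interpret H: wf_digraph H by (rule subgraphE)
  have "{length p |p. H.closed_w p} \<subseteq> T"
  proof
    fix l assume "l \<in> {length p |p. H.closed_w p}"
    then obtain p a where p: "l = length p" "H.awalk a p a" by (auto simp: H.closed_w_def)
    then have pa: "awalk a p a" using sub subgraph_awalk_imp_awalk by blast
    have "a \<in> scc_of i" using p(2) H(2) by auto
    then obtain q where q: "awalk i q a" by (auto simp: scc_of_def reachable_awalk)
    show "l \<in> T"
      unfolding T_def
    proof (intro CollectI ballI)
      fix w assume "w \<in> U"
      \<comment> \<open>Going back \<open>length q\<close> steps turns coordinate \<open>i\<close>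
        of \<open>w\<close> into coordinate \<open>a\<close> of \<open>w'\<close>, up to the shift
        by \<open>v\<close>; there the closed walk at \<open>a\<close> shows that \<open>l\<close>
        is a period.\<close>
      then obtain w' where w': "w' \<in> U" "(f ^^ length q) w' = w" by (rule preimage_funpow)
      have eq: "(f ^^ l) w = (f ^^ length q) ((f ^^ l) w')"
        using w'(2) by (metis add.commute comp_apply funpow_add)
      have "(f ^^ l) w $ i - v $ i = (f ^^ l) w' $ a - v $ a"
        unfolding eq using critical_walk_transport[OF v q funpow_closed[OF w'(1)]] .
      also have "\<dots> = w' $ a - v $ a"
        using critical_walk_transport[OF v pa w'(1)] p(1) by simp
      also have "\<dots> = w $ i - v $ i"
        using critical_walk_transport[OF v q w'(1)] w'(2) by simp
      finally show "(f ^^ l) w $ i = w $ i" by simp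
    qed
  qed
  then have T_cyc: "graph_cyclicity H \<in> T"
    unfolding graph_cyclicity_def
    by (intro Gcd_mem_closed T_add T_diff) (auto simp: T_def)
  have "graph_cyclicity H dvd cyclicity f"
    unfolding cyclicity_def G using H(1) by (intro dvd_Lcm) blast
  then obtain k where k: "cyclicity f = graph_cyclicity H * k" by blast
  have "graph_cyclicity H * n \<in> T" for n
    by (induction n) (use T_add T_cyc in \<open>auto simp: T_def\<close>)
  then show ?thesis using u by (simp add: T_def k)
qed

section \<open>From the critical coordinates to all coordinates\<close>

lemma subdifferential_nonempty: "\<exists>P. P \<in> subdifferential f u"
  using subdifferential_extend[OF convex, of "{}"] by (metis empty_iff)

text \<open>Subgradients can be chosen row by row, so the rows of \<open>P\<close> in
  \<open>S\<close> complete to an element of the subdifferential at \<open>v\<close>. As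
  \<open>S\<close> is closed under its arcs, it contains a final class.\<close>

lemma closed_rows_meet_critical:
  assumes v: "f v = v" and "S \<noteq> {}"
    and row: "\<And>i z. i \<in> S \<Longrightarrow> (\<Sum>j\<in>UNIV. P $ i $ j * (z $ j - v $ j)) \<le> f z $ i - v $ i"
    and closed_S: "\<And>i j. i \<in> S \<Longrightarrow> P $ i $ j \<noteq> 0 \<Longrightarrow> j \<in> S"
  shows "S \<inter> verts (critical_graph_at f v) \<noteq> {}"
proof -
  obtain Q where Q: "Q \<in> subdifferential f v" "\<And>i. i \<in> S \<Longrightarrow> Q $ i = P $ i"
    using subdifferential_extend[OF convex, of S P v] row v by metis
  let ?R = "{(i, j). Q $ i $ j \<noteq> 0}"
  have "j \<in> S" if "i \<in> S" "(i, j) \<in> ?R" for i j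
    using that closed_S Q(2) by auto
  then obtain i where i: "i \<in> S" "\<And>j. (i, j) \<in> ?R\<^sup>* \<Longrightarrow> (j, i) \<in> ?R\<^sup>*"
    using final_state_exists[of S ?R] assms(2) finite_code by metis
  have "?R\<^sup>* `` {i} \<in> final_classes (matrix_graph Q)"
    unfolding final_classes_matrix_graph using i(2) by (auto intro: rtrancl_trans)
  then have "i \<in> verts (final_graph Q)" unfolding verts_final_graph by blast
  then show ?thesis using i(1) Q(1) by (auto simp: critical_graph_at_def)
qed

lemma period_at_critical_increasing:
  assumes v: "f v = v" and "u \<in> U"
    and crit: "\<And>i u. i \<in> verts (critical_graph_at f v) \<Longrightarrow> u \<in> U \<Longrightarrow> (f ^^ N) u $ i = u $ i"
  shows "u \<le> (f ^^ N) u"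
proof -
  obtain p where p: "\<And>u. p u \<in> subdifferential f u" using subdifferential_nonempty by metis
  let ?E = "orbit_arcs f U p"
  define d where "d = (\<lambda>(u, i). (f ^^ N) u $ i - u $ i)"
  have "finite (U \<times> (UNIV :: 'n set))" "U \<times> (UNIV :: 'n set) \<noteq> {}" using finite_U assms(2) by auto
  then obtain s where s: "s \<in> U \<times> UNIV" "\<And>t. t \<in> U \<times> UNIV \<Longrightarrow> d s \<le> d t"
    by (rule finite_min_exists[where h = d]) blast
  define I where "I = {t \<in> U \<times> UNIV. d t = d s}"
  \<comment> \<open>The subgradient at \<open>w\<close>, tested at \<open>(f ^^ N) w\<close>, bounds
    the mean of \<open>d (w, j)\<close> by \<open>d (f w, i)\<close>. As that is already the
    minimum, all successors attain it.\<close>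
  have I_closed: "t' \<in> I" if t: "t \<in> I" "(t, t') \<in> ?E" for t t'
  proof -
    obtain w i j where *: "t = (f w, i)" "t' = (w, j)" "w \<in> U" "p w $ i $ j \<noteq> 0"
      using t(2) by (auto simp: orbit_arcs_def)
    have "(\<Sum>j\<in>UNIV. p w $ i $ j * ((f ^^ N) w $ j - w $ j)) \<le> f ((f ^^ N) w) $ i - f w $ i"
      using p[of w] unfolding subdifferential_iff by blast
    also have "\<dots> = d t" by (simp add: * d_def funpow_swap1)
    also have "\<dots> = d s" using t(1) by (simp add: I_def)
    finally have "d (w, j) = d s"
      using weighted_mean_le_min[of "\<lambda>j. p w $ i $ j" "\<lambda>j. d (w, j)" "d s" j]
        subdifferential_nonneg[OF mono p] subdifferential_row_sum[OF hom p] s(2) *(3,4)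
      by (auto simp: d_def)
    then show ?thesis using * by (simp add: I_def)
  qed
  have "finite I" "I \<noteq> {}" using finite_U s(1) by (auto simp: I_def)
  then obtain r where r: "r \<in> I" "?E\<^sup>* `` {r} \<subseteq> I" "\<And>t. (r, t) \<in> ?E\<^sup>* \<Longrightarrow> (t, r) \<in> ?E\<^sup>*"
    using final_state_exists[of I ?E] I_closed by metis
  define F where "F = ?E\<^sup>* `` {r}"
  define h where "h = (\<lambda>(u, i). v $ i - u $ i)"
  have h: "h t = h r" if "t \<in> F" for t
  proof (rule superharmonic_const[of p "\<lambda>u. u", OF p _ r(3)])
    show "(r, t) \<in> ?E\<^sup>*" using that by (simp add: F_def)
    show "(\<Sum>j\<in>UNIV. p w $ i $ j * h (w, j)) \<le> h (f w, i)" for w i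
      using p[of w, unfolded subdifferential_iff, rule_format, of i v] v by (simp add: h_def)
  qed
  \<comment> \<open>The arcs leaving \<open>(f w, i)\<close> are given by row \<open>i\<close> of
    \<open>p w\<close>, so for each coordinate met by \<open>F\<close> a point one time step earlier
    is needed. Several may qualify; \<open>g\<close> selects one.\<close>
  have "\<exists>w\<in>U. (f w, i) \<in> F" if i: "i \<in> snd ` F" for i
  proof -
    obtain y where y: "(y, i) \<in> F" using i by auto
    then have "y \<in> U" using r(2) by (auto simp: F_def I_def)
    then obtain w where "w \<in> U" "(f ^^ 1) w = y" using preimage_funpow by metis
    then show ?thesis using y by auto
  qed
  then obtain g where g: "\<And>i. i \<in> snd ` F \<Longrightarrow> g i \<in> U \<and> (f (g i), i) \<in> F" by metis
  define P where "P = (\<chi> i. p (g i) $ i)"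
  have succ: "(g i, j) \<in> F" if "i \<in> snd ` F" "P $ i $ j \<noteq> 0" for i j
  proof -
    have "((f (g i), i), (g i, j)) \<in> ?E" using that g[OF that(1)] by (auto simp: orbit_arcs_def P_def)
    then show ?thesis using g[OF that(1)] unfolding F_def by (auto intro: rtrancl_into_rtrancl)
  qed
  have "snd ` F \<inter> verts (critical_graph_at f v) \<noteq> {}"
  proof (rule closed_rows_meet_critical[OF v])
    show "snd ` F \<noteq> {}" by (auto simp: F_def)
    show "j \<in> snd ` F" if "i \<in> snd ` F" "P $ i $ j \<noteq> 0" for i j
      using succ[OF that] by force
    show "(\<Sum>j\<in>UNIV. P $ i $ j * (z $ j - v $ j)) \<le> f z $ i - v $ i" if i: "i \<in> snd ` F" for i z
    proof -
      \<comment> \<open>On every successor \<open>j\<close> the difference between \<open>v\<close>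
        and \<open>g i\<close> is the constant \<open>h r\<close>. The row sum is 1, so moving the
        base point from \<open>g i\<close> to \<open>v\<close> shifts both sides of the subgradient
        inequality by \<open>h r\<close>.\<close>
      have "P $ i $ j * (z $ j - v $ j) = P $ i $ j * (z $ j - g i $ j) - P $ i $ j * h r" for j
        using h[OF succ[OF i]] by (cases "P $ i $ j = 0") (auto simp: h_def algebra_simps)
      then have "(\<Sum>j\<in>UNIV. P $ i $ j * (z $ j - v $ j))
          = (\<Sum>j\<in>UNIV. P $ i $ j * (z $ j - g i $ j)) - h r"
        using subdifferential_row_sum[OF hom p, of "g i" i]
        by (simp add: sum_subtractf P_def flip: sum_distrib_right)
      also have "\<dots> \<le> f z $ i - f (g i) $ i - h r"
        using p[of "g i"] by (simp add: P_def subdifferential_iff)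
      also have "\<dots> = f z $ i - v $ i"
        using h[of "(f (g i), i)"] g[OF i] by (simp add: h_def)
      finally show ?thesis .
    qed
  qed
  then obtain w i where w: "(w, i) \<in> F" "i \<in> verts (critical_graph_at f v)" by auto
  then have "w \<in> U" "d (w, i) = d s" using r(2) by (auto simp: F_def I_def)
  then have "d s = 0" using crit[OF w(2)] by (simp add: d_def)
  then show ?thesis using s(2)[of "(u, _)"] assms(2) by (auto simp: less_eq_vec_def d_def)
qed

text \<open>The iterates at multiples of \<open>N\<close> increase, and the one at
  \<open>N * c\<close> is \<open>u\<close> again.\<close>

lemma funpow_fixed_if_increasing:
  assumes "u \<in> U" "u \<le> (f ^^ N) u"
  shows "(f ^^ N) u = u"
proof (rule antisym)
  have le: "(f ^^ N) u \<le> (f ^^ (N * Suc k)) u" for k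
  proof (induction k)
    case (Suc k)
    have "(f ^^ (N * Suc k)) u \<le> (f ^^ (N * Suc k)) ((f ^^ N) u)" using assms(2) by (rule funpow_mono)
    also have "\<dots> = (f ^^ (N * Suc (Suc k))) u" by (metis add.commute comp_apply funpow_add mult_Suc_right)
    finally show ?case using Suc by order
  qed simp
  show "(f ^^ N) u \<le> u"
    using le[of "c - 1"] funpow_mult_fixed[OF periodic[OF assms(1)], of N] c by (simp add: mult.commute)
qed (rule assms(2))

end

theorem theorem5p5:
  fixes f :: "real^'n \<Rightarrow> real^'n" and x :: "real^'n"
  assumes "convex_map f" and "mono f" and "additively_homogeneous f"
    and "\<exists>c\<ge>1. (f ^^ c) x = x"
  shows "least_power f x dvd cyclicity f"
proof -
  obtain c where c: "1 \<le> c" "(f ^^ c) x = x" using assms(4) by blast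
  define U where "U = range (\<lambda>k. (f ^^ k) x)"
  have "(f ^^ k) x \<in> (\<lambda>k. (f ^^ k) x) ` {..<c}" for k
  proof (rule image_eqI)
    show "(f ^^ k) x = (f ^^ (k mod c)) x" using c(2) by (simp add: funpow_mod_eq)
    show "k mod c \<in> {..<c}" using c(1) by simp
  qed
  then have "U \<subseteq> (\<lambda>k. (f ^^ k) x) ` {..<c}" by (auto simp: U_def)
  then have "finite U" by (rule finite_subset) simp
  moreover have "f u \<in> U" if u: "u \<in> U" for u
  proof -
    obtain k where "u = (f ^^ k) x" using u by (auto simp: U_def)
    then have "f u = (f ^^ Suc k) x" by simp
    then show ?thesis unfolding U_def by blast
  qed
  moreover have "(f ^^ c) u = u" if u: "u \<in> U" for u
  proof -
    obtain k where "u = (f ^^ k) x" using u by (auto simp: U_def)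
    then show ?thesis using c(2) by (metis add.commute comp_apply funpow_add)
  qed
  ultimately interpret periodic_points f U c
    using assms(1-3) c(1) by unfold_locales auto
  have x: "x \<in> U" unfolding U_def by (rule range_eqI[of _ _ 0]) simp
  then obtain v where v: "f v = v" using fixed_point_exists by blast
  have "x \<le> (f ^^ cyclicity f) x"
    using period_at_critical_increasing[OF v x] cyclicity_period_critical[OF v] by blast
  then have "(f ^^ cyclicity f) x = x" by (rule funpow_fixed_if_increasing[OF x])
  then show ?thesis by (rule least_power_minimal)
qed

end
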